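(* Every NMC subshift $X$ is isolated in $\mathbf{S}$, and the set $\mathbf{NMC}$ of NMC subshifts is dense in $\mathbf{S}$. Thus, $\mathbf{NMC}$ is residual in $\mathbf{S}$.
   Context: A subshift is a nonempty compact set $X\subset\mathbb{Z}^{\mathbb{Z}}$ (product topology, $\mathbb{Z}$ discrete) with $\sigma(X)=X$, where $(\sigma x)_i=x_{i+1}$; it is automatically over a finite alphabet. $L_n(X)$ is the set of $n$-letter words occurring in points of $X$. $\mathbf{S}$ is the set of all subshifts with the metric $d(X,Y)=2^{-\inf\{n:L_n(X)\ne L_n(Y)\}}$ ($d(X,X)=0$). A subset is residual if it contains a dense $G_\delta$. The $n$th Rauzy graph $G_{X,n}$ is the directed graph with vertex set $L_{n-1}(X)$ and, for each $w_1\cdots w_n\in L_n(X)$, an edge from $w_1\cdots w_{n-1}$ to $w_2\cdots w_n$. A directed graph has the no middle cycles property (NMC) if it contains no cycle $K$ which has both an incoming edge (an edge whose terminal vertex is in $K$ and whose initial vertex is not in $K$) and an outgoing edge (an edge whose initial vertex is in $K$ and whose terminal vertex is not in $K$). A subshift $X$ is NMC if there exists $n\ge2$ for which $G_{X,n}$ has NMC. *)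

theory Defs
  imports "HOL-Analysis.Analysis" "Graph_Theory.Arc_Walk"
begin

text \<open>
  The type \<open>int \<Rightarrow> int\<close> carries the product topology of the discrete topology on the integers;
  \<open>compact\<close> below refers to it.
\<close>

definition shift_map :: "(int \<Rightarrow> int) \<Rightarrow> (int \<Rightarrow> int)"
  where "shift_map x = (\<lambda>i. x (i + 1))"

definition subshift :: "(int \<Rightarrow> int) set \<Rightarrow> bool"
  where "subshift X \<longleftrightarrow> X \<noteq> {} \<and> compact X \<and> shift_map ` X = X"

definition subshifts :: "(int \<Rightarrow> int) set set"
  where "subshifts = {X. subshift X}"

definition language :: "(int \<Rightarrow> int) set \<Rightarrow> nat \<Rightarrow> int list set"
  where "language X n = {map (\<lambda>k. x (i + int k)) [0..<n] | x i. x \<in> X}"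

definition subshift_dist :: "(int \<Rightarrow> int) set \<Rightarrow> (int \<Rightarrow> int) set \<Rightarrow> real"
  where "subshift_dist X Y =
    (if X = Y then 0 else (1 / 2) ^ Inf {n. language X n \<noteq> language Y n})"

text \<open>
  The arcs are the \<open>n\<close>-letter words themselves. For \<open>n \<ge> 2\<close> a word is determined by its
  prefix and suffix of length \<open>n - 1\<close>, so there are no parallel arcs. Loops may occur.
\<close>

definition rauzy_graph :: "(int \<Rightarrow> int) set \<Rightarrow> nat \<Rightarrow> (int list, int list) pre_digraph"
  where "rauzy_graph X n =
    \<lparr>verts = language X (n - 1), arcs = language X n, tail = butlast, head = tl\<rparr>"

text \<open>
  A cycle is a nonempty closed walk without repeated vertices, given by its list of arcs; a loop
  is a cycle. Its vertex set is the set of tails of its arcs.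
\<close>

definition no_middle_cycles :: "('a, 'b) pre_digraph \<Rightarrow> bool"
  where "no_middle_cycles G \<longleftrightarrow>
    \<not> (\<exists>p. pre_digraph.cycle G p \<and>
        (let K = tail G ` set p in
          (\<exists>e \<in> arcs G. head G e \<in> K \<and> tail G e \<notin> K) \<and>
          (\<exists>e \<in> arcs G. tail G e \<in> K \<and> head G e \<notin> K)))"

definition NMC :: "(int \<Rightarrow> int) set set"
  where "NMC = {X \<in> subshifts. \<exists>n\<ge>2. no_middle_cycles (rauzy_graph X n)}"

definition dense_in :: "'a topology \<Rightarrow> 'a set \<Rightarrow> bool"
  where "dense_in T A \<longleftrightarrow> A \<subseteq> topspace T \<and> T closure_of A = topspace T"

definition residual_in :: "'a topology \<Rightarrow> 'a set \<Rightarrow> bool"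
  where "residual_in T A \<longleftrightarrow> A \<subseteq> topspace T \<and> (\<exists>D \<subseteq> A. gdelta_in T D \<and> dense_in T D)"

definition subshift_topology :: "(int \<Rightarrow> int) set topology"
  where "subshift_topology = Metric_space.mtopology subshifts subshift_dist"

text \<open>\<open>Metric_space.mtopology\<close> is meaningful only for an actual metric space.\<close>

lemma shift_mem:
  assumes "shift_map ` X = X" and "x \<in> X"
  shows "(\<lambda>i. x (i + j)) \<in> X"
proof -
  have up: "(\<lambda>i. y (i + int m)) \<in> X" if "y \<in> X" for y m
  proof (induction m)
    case 0 show ?case using that by simp
  next
    case (Suc m)
    have "shift_map (\<lambda>i. y (i + int m)) \<in> X" using Suc assms(1) by blast
    then show ?case by (simp add: shift_map_def ac_simps)
  qed
  have down: "(\<lambda>i. x (i - int m)) \<in> X" for m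
  proof (induction m)
    case 0 show ?case using assms(2) by simp
  next
    case (Suc m)
    then obtain y where y: "y \<in> X" "shift_map y = (\<lambda>i. x (i - int m))"
      using assms(1) by (metis (no_types, lifting) imageE)
    have "y i = x (i - int (Suc m))" for i
      using fun_cong[OF y(2), of "i - 1"] by (simp add: shift_map_def algebra_simps)
    then have "y = (\<lambda>i. x (i - int (Suc m)))" by blast
    with y(1) show ?case by simp
  qed
  show ?thesis
    using up[OF assms(2), of "nat j"] down[of "nat (- j)"] by (cases "j \<ge> 0") simp_all
qed

lemma subset_of_language_eq:
  assumes X: "subshift X" and Y: "subshift Y" and L: "\<And>n. language X n = language Y n"
  shows "X \<subseteq> Y"
proof
  fix x assume "x \<in> X"
  have "\<exists>y\<in>Y. \<forall>i. - int m \<le> i \<and> i \<le> int m \<longrightarrow> y i = x i" for m :: nat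
  proof -
    let ?n = "2 * m + 1"
    have "map (\<lambda>k. x (- int m + int k)) [0..<?n] \<in> language Y ?n"
      unfolding L[symmetric] unfolding language_def using \<open>x \<in> X\<close> by blast
    then obtain y j where y: "y \<in> Y"
      and eq: "map (\<lambda>k. x (- int m + int k)) [0..<?n] = map (\<lambda>k. y (j + int k)) [0..<?n]"
      unfolding language_def by blast
    have k: "x (- int m + int k) = y (j + int k)" if "k < ?n" for k
      using arg_cong[OF eq, of "\<lambda>l. l ! k"] that by (simp del: upt_Suc)
    have "(\<lambda>i. y (i + (j + int m))) \<in> Y" using shift_mem Y y by (simp add: subshift_def)
    moreover have "y (i + (j + int m)) = x i" if "- int m \<le> i \<and> i \<le> int m" for i
      using k[of "nat (i + int m)"] that by (simp add: nat_less_iff ac_simps)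
    ultimately show ?thesis by (intro bexI[where x = "\<lambda>i. y (i + (j + int m))"]) auto
  qed
  then obtain y where y: "\<And>m. y m \<in> Y"
    and agree: "\<And>m i. - int m \<le> i \<Longrightarrow> i \<le> int m \<Longrightarrow> y m i = x i" by metis
  have "limitin (product_topology (\<lambda>i. euclidean) UNIV) y x sequentially"
    unfolding limitin_componentwise
  proof (intro conjI ballI)
    fix i :: int
    have "y m i = x i" if "nat \<bar>i\<bar> \<le> m" for m using that agree[of m i] by auto
    then have "\<forall>\<^sub>F m in sequentially. y m i = x i" unfolding eventually_sequentially by blast
    then show "limitin euclidean (\<lambda>m. y m i) (x i) sequentially"
      by (simp add: tendsto_eventually)
  qed auto
  then have "y \<longlonglongrightarrow> x" by (simp add: euclidean_product_topology)
  moreover have "closed Y"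
  proof -
    have "Hausdorff_space (euclidean :: int topology)"
      unfolding Hausdorff_space_def by (auto simp: disjnt_def open_discrete separation_t2)
    then have "Hausdorff_space (product_topology (\<lambda>i::int. euclidean :: int topology) UNIV)"
      by (simp add: Hausdorff_space_product_topology)
    then have "Hausdorff_space (euclidean :: (int \<Rightarrow> int) topology)"
      by (simp only: euclidean_product_topology)
    moreover have "compactin euclidean Y" using Y by (simp add: subshift_def)
    ultimately have "closedin euclidean Y" by (rule compactin_imp_closedin)
    then show ?thesis by simp
  qed
  ultimately show "x \<in> Y" by (metis Lim_in_closed_set always_eventually trivial_limit_sequentially y)
qed

lemma language_neq_ex:
  assumes "X \<in> subshifts" "Y \<in> subshifts" "X \<noteq> Y"
  shows "\<exists>n. language X n \<noteq> language Y n"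
  using assms subset_of_language_eq unfolding subshifts_def by (metis equalityI mem_Collect_eq)

lemma Metric_space_subshifts: "Metric_space subshifts subshift_dist"
proof
  fix X Y Z :: "(int \<Rightarrow> int) set"
  show "0 \<le> subshift_dist X Y" by (simp add: subshift_dist_def)
  show "subshift_dist X Y = subshift_dist Y X"
    unfolding subshift_dist_def by (metis (mono_tags, lifting) Collect_cong)
  show "subshift_dist X Y = 0 \<longleftrightarrow> X = Y" by (simp add: subshift_dist_def)
  assume S: "X \<in> subshifts" "Y \<in> subshifts" "Z \<in> subshifts"
  show "subshift_dist X Z \<le> subshift_dist X Y + subshift_dist Y Z"
  proof (cases "X = Z \<or> X = Y \<or> Y = Z")
    case True then show ?thesis by (auto simp: subshift_dist_def)
  next
    case False
    define m where "m = Inf {n. language X n \<noteq> language Z n}"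
    have "m \<in> {n. language X n \<noteq> language Z n}"
      unfolding m_def using language_neq_ex[of X Z] S False by (intro Inf_nat_def1) auto
    then have "language X m \<noteq> language Y m \<or> language Y m \<noteq> language Z m" by auto
    then have "Inf {n. language X n \<noteq> language Y n} \<le> m \<or> Inf {n. language Y n \<noteq> language Z n} \<le> m"
      by (auto intro: cInf_lower)
    then have "(1/2::real) ^ m \<le> (1/2) ^ Inf {n. language X n \<noteq> language Y n} \<or>
               (1/2::real) ^ m \<le> (1/2) ^ Inf {n. language Y n \<noteq> language Z n}"
      by (auto intro: power_decreasing)
    moreover have "0 \<le> (1/2::real) ^ Inf {n. language X n \<noteq> language Y n}"
      "0 \<le> (1/2::real) ^ Inf {n. language Y n \<noteq> language Z n}" by simp_all
    ultimately show ?thesis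
      using False unfolding subshift_dist_def m_def[symmetric] by argo
  qed
qed

lemma topspace_subshift_topology [simp]: "topspace subshift_topology = subshifts"
  unfolding subshift_topology_def by (rule Metric_space.topspace_mtopology[OF Metric_space_subshifts])

end

theory Submission
  imports Defs
begin

text \<open>
  A point of a subshift \<open>X\<close> is a bi-infinite walk in each Rauzy graph of \<open>X\<close>.

  \<^emph>\<open>NMC subshifts are isolated.\<close> Let \<open>G\<close> be the \<open>n\<close>-th Rauzy graph of \<open>X\<close>, without middle
  cycles. A cycle of \<open>G\<close> has no chord, since a chord would cut out a shorter cycle that the
  rest of the old one enters and leaves. So either every arc that starts on the cycle runs along it,
  and a walk through one of its vertices has a determined future, or every arc that ends on the
  cycle runs along it, and such a walk has a determined past (\<open>cycle_determines\<close>).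
  By the pigeonhole principle every walk meets such a determining vertex within every stretch of
  \<open>M + 1\<close> vertices, where \<open>M\<close> is the number of vertices of \<open>G\<close>. If a past-determining vertex
  is followed by a future-determining one and none lies in between, the two are at distance at
  most \<open>M + 1\<close>, so the whole walk is determined by a word of length \<open>n + M\<close>. Hence two subshifts that share
  the words of length \<open>n + M\<close> share all words (\<open>language_eq_if_no_middle_cycles\<close>) and are equal.

  \<^emph>\<open>NMC subshifts are dense.\<close> Given \<open>X\<close> and \<open>n\<close>, let \<open>V\<close> be the set of \<open>n\<close>-letter words of \<open>X\<close>,
  viewed as a graph in which overlapping words are joined. Choose for each word a
  successor \<open>f v\<close> and a predecessor \<open>g v\<close> in \<open>V\<close>. The points that follow \<open>g\<close> towards the past and
  \<open>f\<close> towards the future, with at most one step in between that does neither, form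
  a subshift with the same \<open>n\<close>-letter words as \<open>X\<close>. A cycle of a high Rauzy graph of this subshift is
  a periodic point, which follows \<open>f\<close> throughout or \<open>g\<close> throughout. In the first case the only way
  to leave the cycle would be from a long stretch that follows both \<open>f\<close> and \<open>g\<close>, which
  contains a cycle that \<open>f\<close> runs forwards and \<open>g\<close> runs backwards; in the
  second case the same holds for entering it. So it suffices to choose \<open>f\<close> and \<open>g\<close> such
  that a cycle common to both has no other arcs at its vertices. This is achieved by minimising the number of
  vertices on common cycles: at a vertex with another arc, redirecting \<open>f\<close> or \<open>g\<close> along
  that arc destroys a common cycle and creates none (\<open>exists_isolating_choice\<close>).

  The set of NMC subshifts is then a union of open singletons and dense, hence residual.
\<close>

section \<open>Cycles in digraphs without middle cycles\<close>

lemma (in pre_digraph) cas_iff_nth: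
  assumes "p \<noteq> []"
  shows "cas u p v \<longleftrightarrow> tail G (p ! 0) = u
    \<and> (\<forall>k. Suc k < length p \<longrightarrow> head G (p ! k) = tail G (p ! Suc k)) \<and> head G (last p) = v"
  using assms
proof (induction p arbitrary: u)
  case (Cons a p)
  show ?case
  proof (cases "p = []")
    case False
    then obtain m where m: "length p = Suc m" by (cases p) auto
    have "(\<forall>k. Suc k < length (a # p) \<longrightarrow> head G ((a # p) ! k) = tail G ((a # p) ! Suc k)) \<longleftrightarrow>
        head G a = tail G (p ! 0) \<and> (\<forall>k. Suc k < length p \<longrightarrow> head G (p ! k) = tail G (p ! Suc k))"
      by (simp add: m All_less_Suc2)
    then show ?thesis
      using Cons.IH[OF False] False by auto
  qed auto
qed simp

lemma (in wf_digraph) cycle_iff_nth: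
  "cycle p \<longleftrightarrow> p \<noteq> [] \<and> set p \<subseteq> arcs G \<and> distinct (map (tail G) p)
    \<and> (\<forall>k<length p. head G (p ! k) = tail G (p ! (Suc k mod length p)))"
proof (cases "p = []")
  case True then show ?thesis by (simp add: cycle_def)
next
  case False
  then obtain a q where p: "p = a # q" by (cases p) auto
  have step: "(\<forall>k<length p. head G (p ! k) = tail G (p ! (Suc k mod length p))) \<longleftrightarrow>
      (\<forall>k. Suc k < length p \<longrightarrow> head G (p ! k) = tail G (p ! Suc k)) \<and> head G (last p) = tail G (p ! 0)"
    (is "?A \<longleftrightarrow> ?B")
  proof
    assume ?A
    moreover have "head G (last p) = tail G (p ! 0)"
      using \<open>?A\<close>[rule_format, of "length p - 1"] False by (simp add: last_conv_nth)
    ultimately show ?B by (metis Suc_lessD mod_less)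
  next
    assume B: ?B
    show ?A
    proof (intro allI impI)
      fix k assume "k < length p"
      then consider "Suc k < length p" | "Suc k = length p" by linarith
      then show "head G (p ! k) = tail G (p ! (Suc k mod length p))"
      proof cases
        case 2
        then have "p ! k = last p" using False by (simp add: last_conv_nth flip: 2)
        then show ?thesis using B 2 by simp
      qed (use B in simp)
    qed
  qed
  have "cycle p \<longleftrightarrow> set p \<subseteq> arcs G \<and> cas (tail G a) p (tail G a) \<and> distinct (tl (awalk_verts (tail G a) p))"
    unfolding cycle_def awalk_def using p by auto
  also have "\<dots> \<longleftrightarrow> set p \<subseteq> arcs G \<and> cas (tail G a) p (tail G a) \<and> distinct (map (tail G) p)"
  proof -
    have "distinct (tl (awalk_verts (tail G a) p)) \<longleftrightarrow> distinct (map (tail G) p)"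
      if "cas (tail G a) p (tail G a)"
    proof -
      have "head G (last p) = tail G a"
        using that False by (simp add: cas_iff_nth)
      then have "tl (awalk_verts (tail G a) p) = map (tail G) q @ [tail G a]"
        by (simp only: awalk_verts_conv) (simp add: p)
      then show ?thesis by (auto simp: p)
    qed
    then show ?thesis by blast
  qed
  also have "\<dots> \<longleftrightarrow> set p \<subseteq> arcs G \<and> distinct (map (tail G) p)
      \<and> (\<forall>k<length p. head G (p ! k) = tail G (p ! (Suc k mod length p)))"
    unfolding step cas_iff_nth[OF False] using p by auto
  finally show ?thesis
    using False by blast
qed

lemma (in wf_digraph) cycle_rotate:
  assumes "cycle p"
  shows "cycle (rotate m p)"
proof -
  have *: "cycle (rotate1 q)" if q: "cycle q" for q
  proof -
    obtain L where L: "length q = Suc L" using q by (cases q) (auto simp: cycle_def)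
    have mod: "(Suc (Suc k mod Suc L)) mod Suc L = Suc (Suc k) mod Suc L" for k by (simp add: mod_Suc_eq)
    from q show ?thesis
      unfolding cycle_iff_nth by (auto simp: nth_rotate1 L mod rotate1_map[symmetric])
  qed
  show ?thesis using assms by (induction m) (auto simp: *)
qed

lemma (in wf_digraph) cycle_distinct_heads:
  assumes "cycle p"
  shows "distinct (map (head G) p)"
proof -
  have "map (head G) p = rotate1 (map (tail G) p)"
    using assms unfolding cycle_iff_nth by (intro nth_equalityI) (auto simp: nth_rotate1)
  then show ?thesis using assms unfolding cycle_iff_nth by simp
qed

text \<open>
  Let \<open>e\<close> run between vertices of the cycle \<open>p\<close>. Following \<open>p\<close> from the head of \<open>e\<close> to its tail and
  returning along \<open>e\<close> is a cycle as well. If \<open>e\<close> is not parallel to an arc of \<open>p\<close>, this cycle misses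
  some vertices of \<open>p\<close>, so \<open>p\<close> both leaves and re-enters it, and it is a middle cycle.
\<close>

lemma (in wf_digraph) no_middle_cycles_chordless:
  assumes nmc: "no_middle_cycles G" and p: "cycle p"
    and e: "e \<in> arcs G" "tail G e \<in> tail G ` set p" "head G e \<in> tail G ` set p"
  shows "\<exists>e'\<in>set p. tail G e' = tail G e \<and> head G e' = head G e"
proof -
  \<comment> \<open>Rotate the cycle to start at the head of \<open>e\<close>, so that the shortcut keeps an initial segment.\<close>
  obtain m where m: "m < length p" "tail G (p ! m) = head G e"
    using e(3) by (auto simp: in_set_conv_nth)
  define q where "q = rotate m p"
  have q: "cycle q" and set_q: "set q = set p" and q0: "tail G (q ! 0) = head G e"
  proof -
    have "rotate m p ! 0 = p ! m" using m(1) by (subst nth_rotate) auto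
    then show "tail G (q ! 0) = head G e" using m(2) by (simp add: q_def)
  qed (use cycle_rotate[OF p] in \<open>auto simp: q_def\<close>)
  have step: "head G (q ! k) = tail G (q ! (Suc k mod length q))" if "k < length q" for k
    using q that unfolding cycle_iff_nth by auto
  have dist: "distinct (map (tail G) q)" and ne: "q \<noteq> []" and arcs_q: "set q \<subseteq> arcs G"
    using q unfolding cycle_iff_nth by auto
  obtain a where a: "a < length q" "tail G (q ! a) = tail G e"
    using e(2) set_q by (metis imageE in_set_conv_nth)
  show ?thesis
  proof (cases "Suc a = length q")
    case True
    then have "head G (q ! a) = head G e" using step[OF a(1)] q0 by simp
    then show ?thesis using a set_q nth_mem by metis
  next
    case False
    with a have a1: "Suc a < length q" by simp
    define r where "r = take a q @ [e]"
    have len: "length r = Suc a" using a by (simp add: r_def)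
    have tails: "map (tail G) r = take (Suc a) (map (tail G) q)"
      using a by (simp add: r_def take_Suc_conv_app_nth take_map)
    have nth: "tail G (r ! k) = tail G (q ! k)" if "k \<le> a" for k
      using arg_cong[OF tails, of "\<lambda>l. l ! k"] that a1 len by simp
    have "cycle r"
      unfolding cycle_iff_nth
    proof (intro conjI allI impI)
      show "r \<noteq> []" by (simp add: r_def)
      show "set r \<subseteq> arcs G" using arcs_q e set_take_subset[of a q] by (auto simp: r_def)
      show "distinct (map (tail G) r)" unfolding tails using dist by simp
      fix k assume "k < length r"
      then consider "k < a" | "k = a" unfolding len by linarith
      then show "head G (r ! k) = tail G (r ! (Suc k mod length r))"
      proof cases
        case 1
        then have "head G (r ! k) = tail G (q ! Suc k)"
          using step[of k] a1 by (simp add: r_def nth_append)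
        then show ?thesis using 1 nth[of "Suc k"] by (simp add: len)
      next
        case 2
        then show ?thesis using nth[of 0] q0 a by (simp add: len) (simp add: r_def nth_append)
      qed
    qed
    define K where "K = tail G ` set r"
    have K: "K = set (take (Suc a) (map (tail G) q))" unfolding K_def tails[symmetric] by simp
    have notin: "tail G (q ! k) \<notin> K" if "a < k" "k < length q" for k
    proof
      assume "tail G (q ! k) \<in> K"
      then obtain l where "l \<le> a" "tail G (q ! l) = tail G (q ! k)"
        using a1 unfolding K by (auto simp: in_set_conv_nth less_Suc_eq_le)
      then show False using dist that a1 by (simp add: distinct_conv_nth)
    qed
    have inK: "tail G (q ! k) \<in> K" if "k \<le> a" for k
      using that a1 nth[OF that] len unfolding K_def by (metis image_eqI le_imp_less_Suc nth_mem)
    \<comment> \<open>The arc of \<open>q\<close> after the shortcut leaves \<open>K\<close>, and the last arc of \<open>q\<close> enters it.\<close>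
    have "q ! a \<in> arcs G" "tail G (q ! a) \<in> K" "head G (q ! a) \<notin> K"
      using arcs_q a(1) inK[of a] notin[of "Suc a"] a1 step[OF a(1)] by auto
    moreover have "last q \<in> arcs G" "tail G (last q) \<notin> K" "head G (last q) \<in> K"
      using arcs_q ne notin[of "length q - 1"] a1 inK[of 0] step[of "length q - 1"]
      by (auto simp: last_conv_nth)
    ultimately have "\<not> no_middle_cycles G"
      using \<open>cycle r\<close> unfolding no_middle_cycles_def K_def Let_def by blast
    then show ?thesis using nmc by simp
  qed
qed

text \<open>
  The cycle has no arcs to the outside or no arcs from the outside. As it also has no chords, walks from
  its vertices are forced forwards in the first case, and walks to its vertices are forced backwards
  in the second.
\<close>

lemma (in wf_digraph) no_middle_cycles_one_way:
  assumes nmc: "no_middle_cycles G" and p: "cycle p"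
  shows "(\<forall>e\<in>arcs G. tail G e \<in> tail G ` set p \<longrightarrow> (\<exists>e'\<in>set p. tail G e' = tail G e \<and> head G e' = head G e))
       \<or> (\<forall>e\<in>arcs G. head G e \<in> tail G ` set p \<longrightarrow> (\<exists>e'\<in>set p. tail G e' = tail G e \<and> head G e' = head G e))"
  using nmc p no_middle_cycles_chordless[OF nmc p]
  unfolding no_middle_cycles_def Let_def by metis

section \<open>Words and languages\<close>

definition window :: "(int \<Rightarrow> int) \<Rightarrow> int \<Rightarrow> nat \<Rightarrow> int list"
  where "window x i n = map (\<lambda>k. x (i + int k)) [0..<n]"

lemma length_window [simp]: "length (window x i n) = n"
  by (simp add: window_def)

lemma nth_window [simp]: "k < n \<Longrightarrow> window x i n ! k = x (i + int k)"
  by (simp add: window_def)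

lemma window_eq_iff: "window x i n = window y j n \<longleftrightarrow> (\<forall>k<n. x (i + int k) = y (j + int k))"
  by (simp add: list_eq_iff_nth_eq)

lemma window_eqD:
  "window x i n = window y j n \<Longrightarrow> i \<le> t \<Longrightarrow> t < i + int n \<Longrightarrow> x t = y (j + (t - i))"
  unfolding window_eq_iff by (drule spec[of _ "nat (t - i)"]) auto

lemma butlast_window: "butlast (window x i n) = window x i (n - 1)"
  by (simp add: list_eq_iff_nth_eq nth_butlast)

lemma tl_window: "tl (window x i n) = window x (i + 1) (n - 1)"
  by (simp add: list_eq_iff_nth_eq nth_tl ac_simps)

lemma window_subwindow:
  assumes "window x i N = window y j N" "k + n \<le> N"
  shows "window x (i + int k) n = window y (j + int k) n"
  unfolding window_eq_iff
proof (intro allI impI)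
  fix l assume "l < n"
  then show "x (i + int k + int l) = y (j + int k + int l)"
    using assms unfolding window_eq_iff by (auto dest!: spec[of _ "k + l"] simp: ac_simps)
qed

lemma language_iff: "w \<in> language X n \<longleftrightarrow> (\<exists>x\<in>X. \<exists>i. w = window x i n)"
  unfolding language_def window_def by blast

lemma window_in_language: "x \<in> X \<Longrightarrow> window x i n \<in> language X n"
  unfolding language_iff by blast

lemma length_language: "w \<in> language X n \<Longrightarrow> length w = n"
  unfolding language_iff by auto

lemma language_subset_mono:
  assumes "language X N \<subseteq> language Y N" "m \<le> N"
  shows "language X m \<subseteq> language Y m"
proof
  fix w assume "w \<in> language X m"
  then obtain x i where x: "x \<in> X" "w = window x i m" unfolding language_iff by blast
  then obtain y j where "y \<in> Y" "window x i N = window y j N"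
    using assms(1) window_in_language[OF x(1), of i N] by (metis language_iff subsetD)
  then show "w \<in> language Y m"
    using window_subwindow[of x i N y j 0 m] assms(2) x(2) unfolding language_iff by auto
qed

lemma finite_language:
  assumes X: "subshift X"
  shows "finite (language X n)"
proof -
  have "compact ((\<lambda>x. x 0) ` X)"
    using X unfolding subshift_def
    by (intro compact_continuous_image continuous_on_subset[OF continuous_on_product_coordinates]) auto
  moreover have "discrete ((\<lambda>x. x 0) ` X)"
    unfolding discrete_def isolated_in_islimpt_iff by (auto simp: islimpt_def intro: open_discrete)
  ultimately have fin: "finite ((\<lambda>x. x 0) ` X)"
    using discrete_compact_finite_iff by blast
  have "x i \<in> (\<lambda>x. x 0) ` X" if "x \<in> X" for x i
    using shift_mem[of X x i] X that unfolding subshift_def by (auto intro: rev_image_eqI)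
  then have "language X n \<subseteq> {w. set w \<subseteq> (\<lambda>x. x 0) ` X \<and> length w = n}"
    by (auto simp: language_iff window_def)
  then show ?thesis using finite_lists_length_eq[OF fin] finite_subset by blast
qed

lemma wf_digraph_rauzy_graph: "wf_digraph (rauzy_graph X n)"
proof
  fix e assume "e \<in> arcs (rauzy_graph X n)"
  then obtain x i where "x \<in> X" "e = window x i n" by (auto simp: rauzy_graph_def language_iff)
  then show "tail (rauzy_graph X n) e \<in> verts (rauzy_graph X n)"
    and "head (rauzy_graph X n) e \<in> verts (rauzy_graph X n)"
    by (auto simp: rauzy_graph_def butlast_window tl_window window_in_language)
qed

section \<open>NMC subshifts are determined by finitely many words\<close>

text \<open>
  The pair of minimal distance has the last property. Below, pigeonhole arguments bound or exploit the
  length of a gap in which neither \<open>P\<close> nor \<open>Q\<close> occurs.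
\<close>

lemma closest_pair:
  fixes a b :: int
  assumes "P a" "Q b" "a < b"
  obtains i j where "P i" "Q j" "i < j" "\<And>k. i < k \<Longrightarrow> k < j \<Longrightarrow> \<not> P k \<and> \<not> Q k"
proof -
  define m where "m = (LEAST m. \<exists>i. 0 < m \<and> P i \<and> Q (i + int m))"
  have ex: "\<exists>i. 0 < m \<and> P i \<and> Q (i + int m)"
    unfolding m_def by (rule LeastI[of _ "nat (b - a)"]) (use assms in auto)
  have least: "m \<le> k" if "0 < k" "P i" "Q (i + int k)" for k i
    unfolding m_def using that by (intro Least_le) blast
  obtain i where i: "0 < m" "P i" "Q (i + int m)" using ex by blast
  show thesis
  proof (rule that[of i "i + int m"])
    fix k assume k: "i < k" "k < i + int m"
    show "\<not> P k \<and> \<not> Q k"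
      using least[of "nat (i + int m - k)" k] least[of "nat (k - i)" i] k i by auto
  qed (use i in auto)
qed

text \<open>
  The walks in the \<open>n\<close>-th Rauzy graph are the sequences \<open>x\<close> whose \<open>n\<close>-letter windows lie in \<open>E\<close>,
  and \<open>v\<close> is a vertex, a word of length \<open>n - 1\<close>. The two walks may pass through \<open>v\<close> at different
  times.
\<close>

definition determines_future :: "int list set \<Rightarrow> nat \<Rightarrow> int list \<Rightarrow> bool"
  where "determines_future E n v \<longleftrightarrow> (\<forall>x y i j. range (\<lambda>t. window x t n) \<subseteq> E \<longrightarrow> range (\<lambda>t. window y t n) \<subseteq> E
    \<longrightarrow> window x i (n - 1) = v \<longrightarrow> window y j (n - 1) = v
    \<longrightarrow> (\<forall>k. window x (i + int k) (n - 1) = window y (j + int k) (n - 1)))"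

definition determines_past :: "int list set \<Rightarrow> nat \<Rightarrow> int list \<Rightarrow> bool"
  where "determines_past E n v \<longleftrightarrow> (\<forall>x y i j. range (\<lambda>t. window x t n) \<subseteq> E \<longrightarrow> range (\<lambda>t. window y t n) \<subseteq> E
    \<longrightarrow> window x i (n - 1) = v \<longrightarrow> window y j (n - 1) = v
    \<longrightarrow> (\<forall>k. window x (i - int k) (n - 1) = window y (j - int k) (n - 1)))"

lemma determines_futureD:
  assumes "determines_future E n (window x i (n - 1))"
    and "range (\<lambda>t. window x t n) \<subseteq> E" "range (\<lambda>t. window y t n) \<subseteq> E"
    and "window x i (n - 1) = window y j (n - 1)" "i \<le> t"
  shows "window x t (n - 1) = window y (j + (t - i)) (n - 1)"
  using assms(1)[unfolded determines_future_def, rule_format, of x y i j "nat (t - i)"] assms(2-)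
  by simp

lemma determines_pastD:
  assumes "determines_past E n (window x i (n - 1))"
    and "range (\<lambda>t. window x t n) \<subseteq> E" "range (\<lambda>t. window y t n) \<subseteq> E"
    and "window x i (n - 1) = window y j (n - 1)" "t \<le> i"
  shows "window x t (n - 1) = window y (j + (t - i)) (n - 1)"
proof -
  have eq: "i - int (nat (i - t)) = t" "j - int (nat (i - t)) = j + (t - i)" using assms(5) by auto
  have "window x (i - int (nat (i - t))) (n - 1) = window y (j - int (nat (i - t))) (n - 1)"
    by (rule assms(1)[unfolded determines_past_def, rule_format,
          OF assms(2,3) refl assms(4)[symmetric]])
  then show ?thesis unfolding eq .
qed

text \<open>
  A walk that reaches a one-way cycle moves along it forever, by induction on the number of steps,
  because the arcs of a cycle have distinct tails and distinct heads.
\<close>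

lemma cycle_determines:
  assumes nmc: "no_middle_cycles (rauzy_graph X n)"
    and p: "pre_digraph.cycle (rauzy_graph X n) p"
  shows "(\<forall>v\<in>butlast ` set p. determines_future (language X n) n v)
       \<or> (\<forall>v\<in>butlast ` set p. determines_past (language X n) n v)"
proof -
  interpret wf_digraph "rauzy_graph X n" by (rule wf_digraph_rauzy_graph)
  have G [simp]: "tail (rauzy_graph X n) = butlast" "head (rauzy_graph X n) = tl"
    "arcs (rauzy_graph X n) = language X n"
    by (simp_all add: rauzy_graph_def)
  have K: "butlast ` set p = tl ` set p"
  proof -
    have "distinct (map butlast p)" "distinct (map tl p)" "tl ` set p \<subseteq> butlast ` set p"
      using p cycle_distinct_heads[OF p] unfolding cycle_iff_nth
      by (auto simp: in_set_conv_nth intro!: imageI nth_mem)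
    then have "card (tl ` set p) = card (butlast ` set p)"
      by (simp add: distinct_map card_image)
    then show ?thesis
      using \<open>tl ` set p \<subseteq> butlast ` set p\<close> by (metis card_subset_eq finite_imageI List.finite_set)
  qed
  have inj: "inj_on butlast (set p)" "inj_on tl (set p)"
    using p cycle_distinct_heads[OF p] unfolding cycle_iff_nth by (auto simp: distinct_map)
  show ?thesis using no_middle_cycles_one_way[OF nmc p] unfolding G
  proof
    assume out: "\<forall>e\<in>language X n. butlast e \<in> butlast ` set p \<longrightarrow>
      (\<exists>e'\<in>set p. butlast e' = butlast e \<and> tl e' = tl e)"
    have step: "\<exists>e\<in>set p. butlast e = window z t (n - 1) \<and> tl e = window z (t + 1) (n - 1)"
      if "range (\<lambda>t. window z t n) \<subseteq> language X n" "window z t (n - 1) \<in> butlast ` set p" for z t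
      using bspec[OF out, of "window z t n"] that by (auto simp: butlast_window tl_window)
    have future: "window x (i + int k) (n - 1) = window y (j + int k) (n - 1) \<and>
        window x (i + int k) (n - 1) \<in> butlast ` set p"
      if xy: "range (\<lambda>t. window x t n) \<subseteq> language X n" "range (\<lambda>t. window y t n) \<subseteq> language X n"
        and v: "window x i (n - 1) \<in> butlast ` set p" "window x i (n - 1) = window y j (n - 1)"
      for x y i j k
    proof (induction k)
      case (Suc k)
      obtain e1 where e1: "e1 \<in> set p" "butlast e1 = window x (i + int k) (n - 1)"
          "tl e1 = window x (i + int k + 1) (n - 1)"
        using step[OF xy(1)] Suc by blast
      have "window y (j + int k) (n - 1) \<in> butlast ` set p" using Suc by argo
      then obtain e2 where e2: "e2 \<in> set p" "butlast e2 = window y (j + int k) (n - 1)"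
          "tl e2 = window y (j + int k + 1) (n - 1)"
        using step[OF xy(2)] by blast
      have "e1 = e2" using e1 e2 inj(1) Suc by (metis inj_onD)
      moreover have "tl e1 \<in> butlast ` set p" unfolding K using e1(1) by blast
      ultimately show ?case using e1(3) e2(3) by (simp add: ac_simps)
    qed (use v in auto)
    show ?thesis
    proof (intro disjI1 ballI)
      fix v assume v: "v \<in> butlast ` set p"
      show "determines_future (language X n) n v"
        unfolding determines_future_def
      proof (intro allI impI)
        fix x y i j k
        assume "range (\<lambda>t. window x t n) \<subseteq> language X n" "range (\<lambda>t. window y t n) \<subseteq> language X n"
          "window x i (n - 1) = v" "window y j (n - 1) = v"
        then show "window x (i + int k) (n - 1) = window y (j + int k) (n - 1)"
          using future[of x y i j k] v by argo
      qed
    qed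
  next
    assume inn: "\<forall>e\<in>language X n. tl e \<in> butlast ` set p \<longrightarrow>
      (\<exists>e'\<in>set p. butlast e' = butlast e \<and> tl e' = tl e)"
    have step: "\<exists>e\<in>set p. butlast e = window z (t - 1) (n - 1) \<and> tl e = window z t (n - 1)"
      if "range (\<lambda>t. window z t n) \<subseteq> language X n" "window z t (n - 1) \<in> butlast ` set p" for z t
      using bspec[OF inn, of "window z (t - 1) n"] that by (auto simp: butlast_window tl_window)
    have past: "window x (i - int k) (n - 1) = window y (j - int k) (n - 1) \<and>
        window x (i - int k) (n - 1) \<in> butlast ` set p"
      if xy: "range (\<lambda>t. window x t n) \<subseteq> language X n" "range (\<lambda>t. window y t n) \<subseteq> language X n"
        and v: "window x i (n - 1) \<in> butlast ` set p" "window x i (n - 1) = window y j (n - 1)"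
      for x y i j k
    proof (induction k)
      case (Suc k)
      obtain e1 where e1: "e1 \<in> set p" "butlast e1 = window x (i - int k - 1) (n - 1)"
          "tl e1 = window x (i - int k) (n - 1)"
        using step[OF xy(1)] Suc by blast
      have "window y (j - int k) (n - 1) \<in> butlast ` set p" using Suc by argo
      then obtain e2 where e2: "e2 \<in> set p" "butlast e2 = window y (j - int k - 1) (n - 1)"
          "tl e2 = window y (j - int k) (n - 1)"
        using step[OF xy(2)] by blast
      have "e1 = e2" using e1 e2 inj(2) Suc by (metis inj_onD)
      moreover have "butlast e1 \<in> butlast ` set p" using e1(1) by blast
      moreover have sub: "l - int (Suc k) = l - int k - 1" for l by simp
      ultimately show ?case unfolding sub using e1(2) e2(2) by argo
    qed (use v in auto)
    show ?thesis
    proof (intro disjI2 ballI)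
      fix v assume v: "v \<in> butlast ` set p"
      show "determines_past (language X n) n v"
        unfolding determines_past_def
      proof (intro allI impI)
        fix x y i j k
        assume "range (\<lambda>t. window x t n) \<subseteq> language X n" "range (\<lambda>t. window y t n) \<subseteq> language X n"
          "window x i (n - 1) = v" "window y j (n - 1) = v"
        then show "window x (i - int k) (n - 1) = window y (j - int k) (n - 1)"
          using past[of x y i j k] v by argo
      qed
    qed
  qed
qed

text \<open>
  Two of the \<open>card + 1\<close> vertices starting at position \<open>a\<close> are equal. The walk between the closest two equal
  ones is a cycle without repeated vertices, so its vertices are determining.
\<close>

lemma determining_vertex_nearby:
  assumes X: "subshift X" and nmc: "no_middle_cycles (rauzy_graph X n)"
    and x: "range (\<lambda>t. window x t n) \<subseteq> language X n"
  shows "\<exists>i. a \<le> i \<and> i \<le> a + int (card (language X (n - 1))) \<and>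
    (determines_future (language X n) n (window x i (n - 1)) \<or>
     determines_past (language X n) n (window x i (n - 1)))"
proof -
  interpret wf_digraph "rauzy_graph X n" by (rule wf_digraph_rauzy_graph)
  have G [simp]: "tail (rauzy_graph X n) = butlast" "head (rauzy_graph X n) = tl"
    "arcs (rauzy_graph X n) = language X n"
    by (simp_all add: rauzy_graph_def)
  define M where "M = card (language X (n - 1))"
  define u where "u i = window x i (n - 1)" for i
  have u: "u i \<in> language X (n - 1)" for i
    using tail_in_verts[of "window x i n"] x by (auto simp: u_def butlast_window rauzy_graph_def)
  have "\<not> inj_on (\<lambda>k. u (a + int k)) {..M}"
  proof
    assume "inj_on (\<lambda>k. u (a + int k)) {..M}"
    then have "card {..M} \<le> card (language X (n - 1))"
      using u finite_language[OF X] by (intro card_inj_on_le) auto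
    then show False by (simp add: M_def)
  qed
  then obtain k l where kl: "k \<le> M" "l \<le> M" "k \<noteq> l" "u (a + int k) = u (a + int l)"
    unfolding inj_on_def by auto
  have "\<exists>b. 0 < d \<and> a \<le> b \<and> b + int d \<le> a + int M \<and> u (b + int d) = u b"
    if "d = max k l - min k l" for d
    using kl that by (intro exI[of _ "a + int (min k l)"]) (auto simp: max_def min_def)
  then have ex: "\<exists>d b. 0 < d \<and> a \<le> b \<and> b + int d \<le> a + int M \<and> u (b + int d) = u b"
    by blast
  define d where "d = (LEAST d. \<exists>b. 0 < d \<and> a \<le> b \<and> b + int d \<le> a + int M \<and> u (b + int d) = u b)"
  obtain b where d: "0 < d" and b: "a \<le> b" "b + int d \<le> a + int M" "u (b + int d) = u b"
    using LeastI_ex[OF ex] unfolding d_def by blast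
  have least: "d \<le> d'" if "0 < d'" "a \<le> c" "c + int d' \<le> a + int M" "u (c + int d') = u c" for d' c
    unfolding d_def using that by (intro Least_le) blast
  define p where "p = map (\<lambda>k. window x (b + int k) n) [0..<d]"
  have dist: "k = l" if "k < d" "l < d" "u (b + int k) = u (b + int l)" "k \<le> l" for k l
  proof (rule ccontr)
    assume "k \<noteq> l"
    then have "d \<le> l - k"
      using that b by (intro least[of _ "b + int k"]) auto
    then show False using that d by linarith
  qed
  have "cycle p"
    unfolding cycle_iff_nth
  proof (intro conjI allI impI)
    show "p \<noteq> []" using d by (simp add: p_def)
    show "set p \<subseteq> arcs (rauzy_graph X n)" using x by (auto simp: p_def)
    show "distinct (map (tail (rauzy_graph X n)) p)"
    proof -
      have "k = l" if "k < d" "l < d" "u (b + int k) = u (b + int l)" for k l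
        using dist[of k l] dist[of l k] that by (metis nat_le_linear)
      then show ?thesis
        by (auto simp: p_def distinct_map inj_on_def butlast_window o_def u_def)
    qed
    fix k assume "k < length p"
    then have k: "k < d" by (simp add: p_def)
    then consider "Suc k < d" | "Suc k = d" by linarith
    then show "head (rauzy_graph X n) (p ! k) = tail (rauzy_graph X n) (p ! (Suc k mod length p))"
    proof cases
      case 1
      then show ?thesis by (simp add: p_def butlast_window tl_window ac_simps)
    next
      case 2
      then have "u (b + int k + 1) = u b" using b(3) by (simp add: ac_simps flip: 2)
      then show ?thesis using 2 k d by (simp add: p_def butlast_window tl_window u_def)
    qed
  qed
  moreover have "u b \<in> butlast ` set p"
    using d by (auto simp: p_def u_def butlast_window intro!: rev_image_eqI[of "window x b n"] image_eqI[of _ _ 0])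
  ultimately show ?thesis
    using cycle_determines[OF nmc, of p] b unfolding u_def M_def by (intro exI[of _ b]) auto
qed

text \<open>
  To find a word of one subshift in the other, take determining vertices on both sides of it. If the
  left one determines the future or the right one determines the past, each occurrence of that
  vertex in the other subshift carries the word along. Otherwise a past-determining
  vertex lies to the left and a future-determining one to the right. The closest such pair spans at most
  \<open>n + card\<close> letters, so it occurs in the other subshift too, and there it determines the
  whole sequence.
\<close>

lemma language_eq_if_no_middle_cycles:
  assumes X: "subshift X" and n: "2 \<le> n" and nmc: "no_middle_cycles (rauzy_graph X n)"
    and N: "language X (n + card (language X (n - 1))) = language Y (n + card (language X (n - 1)))"
  shows "language X m = language Y m"
proof -
  define M where "M = card (language X (n - 1))"
  have low: "language X k = language Y k" if "k \<le> n + M" for k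
    using language_subset_mono[of X _ Y k] language_subset_mono[of Y _ X k] that N
    by (metis M_def equalityI order_refl)
  have walk: "range (\<lambda>t. window z t n) \<subseteq> language X n" if "z \<in> X \<union> Y" for z
    using that window_in_language low[of n] by auto
  let ?F = "\<lambda>z i. determines_future (language X n) n (window z i (n - 1))"
  let ?P = "\<lambda>z i. determines_past (language X n) n (window z i (n - 1))"
  have FD: "z t = z' (j + (t - i))"
    if "?F z i" "z \<in> X \<union> Y" "z' \<in> X \<union> Y" "window z i (n - 1) = window z' j (n - 1)" "i \<le> t"
    for z z' i j t
  proof -
    have "window z t (n - 1) = window z' (j + (t - i)) (n - 1)"
      using that(1) walk[OF that(2)] walk[OF that(3)] that(4,5) by (rule determines_futureD)
    then show ?thesis
      using window_eqD[of z t "n - 1" z' "j + (t - i)" t] n that(5) by simp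
  qed
  have PD: "z t = z' (j + (t - i))"
    if "?P z i" "z \<in> X \<union> Y" "z' \<in> X \<union> Y" "window z i (n - 1) = window z' j (n - 1)" "t \<le> i"
    for z z' i j t
  proof -
    have "window z t (n - 1) = window z' (j + (t - i)) (n - 1)"
      using that(1) walk[OF that(2)] walk[OF that(3)] that(4,5) by (rule determines_pastD)
    then show ?thesis
      using window_eqD[of z t "n - 1" z' "j + (t - i)" t] n that(5) by simp
  qed
  have near: "\<exists>i. a \<le> i \<and> i \<le> a + int M \<and> (?F z i \<or> ?P z i)" if "z \<in> X \<union> Y" for z a
    unfolding M_def by (rule determining_vertex_nearby[OF X nmc walk[OF that]])
  \<comment> \<open>The argument is symmetric in \<open>X\<close> and \<open>Y\<close>, which have the same Rauzy graph; \<open>A\<close> and \<open>B\<close> are the two in either order.\<close>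
  have copy: "\<exists>z'\<in>B. \<exists>c. \<forall>t. a \<le> t \<longrightarrow> t < a + int m \<longrightarrow> z t = z' (c + t)"
    if z: "z \<in> A" and AB: "A = X \<and> B = Y \<or> A = Y \<and> B = X" for A B z a
  proof -
    have zXY: "z \<in> X \<union> Y" using z AB by auto
    have sub: "z' \<in> X \<union> Y" if "z' \<in> B" for z' using that AB by auto
    have occurs: "\<exists>z'\<in>B. \<exists>j. window z i k = window z' j k" if "k \<le> n + M" for i k
      using window_in_language[OF z, of i k] low[OF that] AB by (metis language_iff)
    have n1: "n - 1 \<le> n + M" by simp
    obtain q where q: "a - int M - 1 \<le> q" "q < a" "?F z q \<or> ?P z q"
      using near[OF zXY, of "a - int M - 1"] by auto
    obtain p where p: "a + int m \<le> p" "?F z p \<or> ?P z p"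
      using near[OF zXY, of "a + int m"] by auto
    consider "?F z q" | "?P z p" | "?P z q" "?F z p" using p q by blast
    then show ?thesis
    proof cases
      case 1
      obtain z' j where z': "z' \<in> B" "window z q (n - 1) = window z' j (n - 1)"
        using occurs[OF n1, of q] by blast
      then have "z t = z' ((j - q) + t)" if "a \<le> t" for t
        using FD[OF 1 zXY sub[OF z'(1)] z'(2), of t] q that by (simp add: algebra_simps)
      then show ?thesis using z'(1) by blast
    next
      case 2
      obtain z' j where z': "z' \<in> B" "window z p (n - 1) = window z' j (n - 1)"
        using occurs[OF n1, of p] by blast
      then have "z t = z' ((j - p) + t)" if "t < a + int m" for t
        using PD[OF 2 zXY sub[OF z'(1)] z'(2), of t] p that by (simp add: algebra_simps)
      then show ?thesis using z'(1) by blast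
    next
      case 3
      have "q < p" using p q by simp
      obtain i l where il: "?P z i" "?F z l" "i < l" "\<And>k. i < k \<Longrightarrow> k < l \<Longrightarrow> \<not> ?P z k \<and> \<not> ?F z k"
        using closest_pair[of "?P z" q "?F z" p, OF 3 \<open>q < p\<close>] by blast
      \<comment> \<open>The \<open>M + 1\<close> positions from \<open>i + 1\<close> on contain a determining vertex, so they reach up to \<open>l\<close>.\<close>
      have gap: "l \<le> i + int M + 1"
        using near[OF zXY, of "i + 1"] il(4) by (smt (verit))
      obtain z' j where z': "z' \<in> B" "window z i (n + M) = window z' j (n + M)"
        using occurs[of "n + M" i] by auto
      have wi: "window z i (n - 1) = window z' j (n - 1)"
        using window_subwindow[OF z'(2), of 0 "n - 1"] by simp
      have wl: "window z l (n - 1) = window z' (j + (l - i)) (n - 1)"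
        using window_subwindow[OF z'(2), of "nat (l - i)" "n - 1"] gap il(3) n by simp
      have "z t = z' ((j - i) + t)" for t
      proof -
        consider "t \<le> i" | "l \<le> t" | "i \<le> t" "t < i + int (n + M)" using gap n by linarith
        then show ?thesis
        proof cases
          case 1
          show ?thesis
            using PD[OF il(1) zXY sub[OF z'(1)] wi 1] by (simp add: algebra_simps)
        next
          case 2
          show ?thesis
            using FD[OF il(2) zXY sub[OF z'(1)] wl 2] by (simp add: algebra_simps)
        next
          case 3
          show ?thesis using window_eqD[OF z'(2) 3] by (simp add: algebra_simps)
        qed
      qed
      then show ?thesis using z'(1) by blast
    qed
  qed
  have sub: "language A m \<subseteq> language B m" if AB: "A = X \<and> B = Y \<or> A = Y \<and> B = X" for A B
  proof
    fix w assume "w \<in> language A m"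
    then obtain z a where z: "z \<in> A" "w = window z a m" unfolding language_iff by blast
    obtain z' c where z': "z' \<in> B" "\<And>t. a \<le> t \<Longrightarrow> t < a + int m \<Longrightarrow> z t = z' (c + t)"
      using copy[OF z(1) AB, of a] by blast
    have "w = window z' (c + a) m"
      unfolding z(2) window_eq_iff using z'(2) by (simp add: ac_simps)
    then show "w \<in> language B m" using z'(1) by (auto simp: window_in_language)
  qed
  then show ?thesis by blast
qed

section \<open>Successor and predecessor choices with isolated common cycles\<close>

text \<open>
  For finite \<open>V\<close>, such a set \<open>K\<close> is a disjoint union of cycles that \<open>f\<close> runs forwards and \<open>g\<close>
  runs backwards. In this form the notion is symmetric in \<open>f\<close> and \<open>g\<close> and closed under unions.
\<close>

definition two_way :: "'a set \<Rightarrow> ('a \<Rightarrow> 'a) \<Rightarrow> ('a \<Rightarrow> 'a) \<Rightarrow> 'a set \<Rightarrow> bool"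
  where "two_way V f g K \<longleftrightarrow> K \<subseteq> V \<and> f ` K \<subseteq> K \<and> g ` K \<subseteq> K \<and> (\<forall>v\<in>K. g (f v) = v \<and> f (g v) = v)"

lemma two_way_commute: "two_way V f g K \<longleftrightarrow> two_way V g f K"
  by (simp only: two_way_def conj_ac)

text \<open>
  If \<open>v\<close> were in \<open>K\<close>, the injective map \<open>g\<close> would permute the finite set \<open>B \<inter> K\<close>, so \<open>v\<close> would be the
  image of some \<open>u\<close> in it. Injectivity of \<open>g\<close> on \<open>B\<close> gives \<open>u = f v\<close>, and injectivity of \<open>g\<close> on
  \<open>K\<close> gives \<open>u = w\<close>.
\<close>

lemma two_way_redirect_avoids:
  assumes fin: "finite V" and B: "two_way V f g B" "v \<in> B" and w: "w \<noteq> f v"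
    and K: "two_way V (f(v := w)) g K"
  shows "v \<notin> K"
proof
  assume v: "v \<in> K"
  have "finite (B \<inter> K)" by (rule finite_subset[OF _ fin]) (use B(1) in \<open>auto simp: two_way_def\<close>)
  moreover have "g ` (B \<inter> K) \<subseteq> B \<inter> K"
    using B(1) K by (auto simp: two_way_def)
  moreover have inj: "inj_on g B" "inj_on g K"
    by (rule inj_on_inverseI[of _ f], use B(1) in \<open>simp add: two_way_def\<close>)
       (rule inj_on_inverseI[of _ "f(v := w)"], use K in \<open>simp add: two_way_def\<close>)
  then have "inj_on g (B \<inter> K)" by (auto intro: inj_on_subset)
  ultimately have "g ` (B \<inter> K) = B \<inter> K" by (simp add: endo_inj_surj)
  then obtain u where u: "u \<in> B" "u \<in> K" "g u = v" 
  proof -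
    have "v \<in> g ` (B \<inter> K)" unfolding \<open>g ` (B \<inter> K) = B \<inter> K\<close> using v B(2) by (rule IntI[rotated])
    then show thesis using that by auto
  qed
  have "f v \<in> B" "g (f v) = v" using B unfolding two_way_def by auto
  then have "f v = u" using inj(1) u by (simp add: inj_on_def)
  moreover have "w \<in> K" "g w = v" using K v unfolding two_way_def by auto
  then have "w = u" using inj(2) u by (simp add: inj_on_def)
  ultimately show False using w by simp
qed

text \<open>
  The sets that are two-way after redirecting \<open>f\<close> avoid \<open>v\<close>, and on them \<open>f\<close> is unchanged. So
  they were two-way before.
\<close>

lemma two_way_redirect:
  assumes "finite V" "two_way V f g B" "v \<in> B" "w \<noteq> f v"
  shows "\<Union>{K. two_way V (f(v := w)) g K} \<subset> \<Union>{K. two_way V f g K}"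
proof -
  have avoid: "v \<notin> K" if "two_way V (f(v := w)) g K" for K
    by (rule two_way_redirect_avoids[OF assms that])
  have "two_way V f g K" if "two_way V (f(v := w)) g K" for K
  proof -
    have same: "(f(v := w)) u = f u" if "u \<in> K" for u
      using avoid[OF \<open>two_way V (f(v := w)) g K\<close>] that by auto
    have "K \<subseteq> V" "(f(v := w)) ` K \<subseteq> K" "g ` K \<subseteq> K"
      and inv: "\<And>u. u \<in> K \<Longrightarrow> g ((f(v := w)) u) = u" "\<And>u. u \<in> K \<Longrightarrow> (f(v := w)) (g u) = u"
      using that by (simp_all only: two_way_def)
    moreover have "(f(v := w)) ` K = f ` K" using same by (rule image_cong[OF refl])
    moreover have "g (f u) = u" "f (g u) = u" if "u \<in> K" for u
      using inv[OF that] same[OF that] same[of "g u"] \<open>g ` K \<subseteq> K\<close> that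
      by (simp_all only: image_subset_iff)
    ultimately show ?thesis unfolding two_way_def by (intro conjI ballI) (simp_all only:)
  qed
  then have "\<Union>{K. two_way V (f(v := w)) g K} \<subseteq> \<Union>{K. two_way V f g K}" by blast
  moreover have "v \<in> \<Union>{K. two_way V f g K}" using assms by blast
  moreover have "v \<notin> \<Union>{K. two_way V (f(v := w)) g K}" using avoid by blast
  ultimately show ?thesis by blast
qed

text \<open>
  Take a choice for which the union of all two-way sets has the fewest elements. If a vertex \<open>v\<close> of
  a two-way set had a successor other than \<open>f v\<close>, redirecting \<open>f\<close> at \<open>v\<close> would
  make the union smaller; likewise for predecessors and \<open>g\<close>.
\<close>

lemma exists_isolating_choice:
  fixes R :: "'a \<Rightarrow> 'a \<Rightarrow> bool"
  assumes fin: "finite V" and succ: "\<And>v. v \<in> V \<Longrightarrow> \<exists>w\<in>V. R v w" and pred: "\<And>v. v \<in> V \<Longrightarrow> \<exists>u\<in>V. R u v"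
  obtains f g where "\<And>v. v \<in> V \<Longrightarrow> f v \<in> V \<and> R v (f v)" "\<And>v. v \<in> V \<Longrightarrow> g v \<in> V \<and> R (g v) v"
    "\<And>K v w. two_way V f g K \<Longrightarrow> v \<in> K \<Longrightarrow> w \<in> V \<Longrightarrow> R v w \<Longrightarrow> w = f v"
    "\<And>K v w. two_way V f g K \<Longrightarrow> v \<in> K \<Longrightarrow> w \<in> V \<Longrightarrow> R w v \<Longrightarrow> w = g v"
proof -
  define choice where "choice = (\<lambda>(f, g). (\<forall>v\<in>V. f v \<in> V \<and> R v (f v)) \<and> (\<forall>v\<in>V. g v \<in> V \<and> R (g v) v))"
  define size where "size = (\<lambda>(f, g). card (\<Union>{K. two_way V f g K}))"
  have "\<exists>f. \<forall>v\<in>V. f v \<in> V \<and> R v (f v)" using succ by (intro bchoice) blast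
  moreover have "\<exists>g. \<forall>v\<in>V. g v \<in> V \<and> R (g v) v" using pred by (intro bchoice) blast
  ultimately obtain f0 g0 where "choice (f0, g0)" unfolding choice_def by fastforce
  then have "\<exists>c. choice c" by (rule exI)
  then obtain c where c: "choice c" "\<And>c'. choice c' \<Longrightarrow> size c \<le> size c'"
    using ex_has_least_nat[of choice _ size] by blast
  obtain f g where fg: "c = (f, g)" by (cases c)
  have f: "f v \<in> V \<and> R v (f v)" and g: "g v \<in> V \<and> R (g v) v" if "v \<in> V" for v
    using c(1) that unfolding choice_def fg by auto
  have fin': "finite (\<Union>{K. two_way V f g K})" for f g :: "'a \<Rightarrow> 'a"
    by (rule finite_subset[OF _ fin]) (auto simp: two_way_def)
  show thesis
  proof (rule that[of f g])
    fix K v w assume K: "two_way V f g K" "v \<in> K" and w: "w \<in> V"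
    show "w = f v" if R: "R v w"
    proof (rule ccontr)
      assume "w \<noteq> f v"
      then have "size (f(v := w), g) < size (f, g)"
        unfolding size_def prod.case by (intro psubset_card_mono[OF fin'] two_way_redirect[OF fin K])
      moreover have "choice (f(v := w), g)" unfolding choice_def prod.case by (auto simp: f g w R)
      ultimately show False using c(2)[of "(f(v := w), g)"] fg by simp
    qed
    show "w = g v" if R: "R w v"
    proof (rule ccontr)
      assume "w \<noteq> g v"
      have K': "two_way V g f K" using K(1) by (rule two_way_commute[THEN iffD1])
      have "\<Union>{K. two_way V (g(v := w)) f K} \<subset> \<Union>{K. two_way V g f K}"
        by (rule two_way_redirect[OF fin K' K(2) \<open>w \<noteq> g v\<close>])
      then have "\<Union>{K. two_way V f (g(v := w)) K} \<subset> \<Union>{K. two_way V f g K}"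
        unfolding two_way_commute[of V "g(v := w)" f] two_way_commute[of V g f] .
      then have "size (f, g(v := w)) < size (f, g)"
        unfolding size_def prod.case by (rule psubset_card_mono[OF fin'])
      moreover have "choice (f, g(v := w))" unfolding choice_def prod.case by (auto simp: f g w R)
      ultimately show False using c(2)[of "(f, g(v := w))"] fg by simp
    qed
  qed (rule f g; assumption)+
qed

text \<open>
  The path has more vertices than \<open>V\<close>, so it visits some vertex twice, and the part between two
  visits is a two-way set. The rest of the path is obtained from it by applying \<open>f\<close> or \<open>g\<close>.
\<close>

lemma two_way_if_long_path:
  assumes fin: "finite V" and V: "f ` V \<subseteq> V" "g ` V \<subseteq> V"
    and h: "\<And>k. k \<le> card V \<Longrightarrow> h k \<in> V"
    and step: "\<And>k. k < card V \<Longrightarrow> f (h k) = h (Suc k) \<and> g (h (Suc k)) = h k"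
  obtains K where "two_way V f g K" "\<And>k. k \<le> card V \<Longrightarrow> h k \<in> K"
proof -
  have "\<not> inj_on h {..card V}"
  proof
    assume "inj_on h {..card V}"
    then have "card {..card V} \<le> card V"
      using h fin by (intro card_inj_on_le) auto
    then show False by simp
  qed
  then obtain b' c' where "b' \<le> card V" "c' \<le> card V" "b' \<noteq> c'" "h b' = h c'"
    unfolding inj_on_def by auto
  then obtain b c where bc: "b < c" "c \<le> card V" "h b = h c"
    by (metis nat_neq_iff)
  define K where "K = h ` {b..<c}"
  have K_closed: "f (h k) \<in> K \<and> g (f (h k)) = h k" if "k \<in> {b..<c}" for k
  proof -
    have "f (h k) = h (Suc k)" "g (f (h k)) = h k" using step[of k] that bc(2) by simp_all
    moreover have "h (Suc k) \<in> K"
    proof (cases "Suc k = c")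
      case True
      then have "h (Suc k) = h b" using bc(3) by simp
      then show ?thesis using bc(1) by (simp add: K_def)
    qed (use that in \<open>simp add: K_def\<close>)
    ultimately show ?thesis by simp
  qed
  have K_closed': "g (h k) \<in> K \<and> f (g (h k)) = h k" if "k \<in> {b..<c}" for k
  proof -
    obtain l where l: "l \<in> {b..<c}" "h k = h (Suc l)"
    proof (cases "k = b")
      case True then show ?thesis using bc by (intro that[of "c - 1"]) simp_all
    next
      case False then show ?thesis using \<open>k \<in> {b..<c}\<close> by (intro that[of "k - 1"]) auto
    qed
    have "g (h k) = h l" "f (h l) = h k" using step[of l] l bc(2) by simp_all
    then show ?thesis using l(1) by (simp add: K_def)
  qed
  have K: "two_way V f g K"
    unfolding two_way_def
  proof (intro conjI ballI subsetI)
    fix u assume "u \<in> K"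
    then obtain k where k: "k \<in> {b..<c}" "u = h k" unfolding K_def by blast
    show "u \<in> V" "g (f u) = u" "f (g u) = u"
      using h[of k] k bc(2) K_closed[OF k(1)] K_closed'[OF k(1)] by simp_all
  next
    fix u assume "u \<in> f ` K"
    then obtain k where "k \<in> {b..<c}" "u = f (h k)" unfolding K_def by blast
    then show "u \<in> K" using K_closed by simp
  next
    fix u assume "u \<in> g ` K"
    then obtain k where "k \<in> {b..<c}" "u = g (h k)" unfolding K_def by blast
    then show "u \<in> K" using K_closed' by simp
  qed
  have fK: "f u \<in> K" and gK: "g u \<in> K" if "u \<in> K" for u
    using K that unfolding two_way_def by (simp_all only: image_subset_iff)
  have up: "h (c + k) \<in> K" if "c + k \<le> card V" for k
    using that
  proof (induction k)
    case 0
    have "h b \<in> K" using bc(1) by (simp add: K_def)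
    then show ?case using bc(3) by simp
  next
    case (Suc k) then show ?case using step[of "c + k"] fK[of "h (c + k)"] by simp
  qed
  have down: "h (b - k) \<in> K" for k
  proof (induction k)
    case 0 show ?case using bc(1) by (simp add: K_def)
  next
    case (Suc k)
    show ?case
    proof (cases "k < b")
      case True
      then have "h (b - Suc k) = g (h (b - k))" using step[of "b - Suc k"] bc by (simp add: Suc_diff_Suc)
      then show ?thesis using Suc gK by simp
    qed (use Suc in simp)
  qed
  have "h k \<in> K" if "k \<le> card V" for k
  proof -
    consider "c \<le> k" | "k \<le> b" | "k \<in> {b..<c}" by fastforce
    then show ?thesis
    proof cases
      case 1 then show ?thesis using up[of "k - c"] that by simp
    next
      case 2 then show ?thesis using down[of "b - k"] by simp
    qed (simp add: K_def)
  qed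
  then show thesis using K that by blast
qed

section \<open>Subshifts steered by a successor and a predecessor choice\<close>

text \<open>
  This reads off a sequence of letters from a walk of words. It is used both for the orbits of the
  successor and predecessor choices and for the periodic sequence of a cycle.
\<close>

lemma window_of_overlapping:
  assumes len: "\<And>i. length (s i) = n" and overlap: "\<And>i. tl (s i) = butlast (s (i + 1))"
  shows "window (\<lambda>i. hd (s i)) i n = s i"
proof -
  have "s i ! k = hd (s (i + int k))" if "k < n" for k
    using that
  proof (induction k arbitrary: i)
    case 0 then show ?case using len[of i] by (simp add: hd_conv_nth flip: length_greater_0_conv)
  next
    case (Suc k)
    have "s i ! Suc k = tl (s i) ! k" using Suc.prems len[of i] by (simp add: nth_tl)
    also have "\<dots> = s (i + 1) ! k" unfolding overlap using Suc.prems len by (simp add: nth_butlast)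
    finally show ?case using Suc.IH[of "i + 1"] Suc.prems by (simp add: ac_simps)
  qed
  then show ?thesis by (auto simp: list_eq_iff_nth_eq len)
qed

lemma rauzy_cycle_sequence:
  assumes p: "pre_digraph.cycle (rauzy_graph Y N) p"
  obtains z P where "0 < P" "\<And>i. z (i + int P) = z i" "set p = range (\<lambda>i. window z i N)"
proof -
  interpret wf_digraph "rauzy_graph Y N" by (rule wf_digraph_rauzy_graph)
  define s where "s i = p ! nat (i mod int (length p))" for i
  have ne: "0 < length p" and sub: "set p \<subseteq> language Y N"
    and nxt: "\<And>k. k < length p \<Longrightarrow> tl (p ! k) = butlast (p ! (Suc k mod length p))"
    using p unfolding cycle_iff_nth by (auto simp: rauzy_graph_def)
  have bound: "nat (i mod int (length p)) < length p" for i
    using ne by (simp add: nat_less_iff)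
  have s: "s i \<in> set p" for i using bound unfolding s_def by simp
  have "tl (s i) = butlast (s (i + 1))" for i
  proof -
    have "nat ((i + 1) mod int (length p)) = nat ((i mod int (length p) + 1) mod int (length p))"
      by (simp only: mod_add_left_eq)
    also have "\<dots> = Suc (nat (i mod int (length p))) mod length p"
      using ne by (simp add: nat_mod_distrib Suc_nat_eq_nat_zadd1 ac_simps)
    finally have "Suc (nat (i mod int (length p))) mod length p = nat ((i + 1) mod int (length p))" ..
    then show ?thesis unfolding s_def nxt[OF bound] by simp
  qed
  moreover have "length (s i) = N" for i using s sub length_language by blast
  ultimately have win: "window (\<lambda>i. hd (s i)) i N = s i" for i
    by (rule window_of_overlapping[rotated])
  have "set p \<subseteq> range s"
  proof
    fix e assume "e \<in> set p"
    then obtain k where "k < length p" "e = p ! k" by (auto simp: in_set_conv_nth)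
    then have "e = s (int k)" by (simp add: s_def)
    then show "e \<in> range s" by blast
  qed
  then have "set p = range (\<lambda>i. window (\<lambda>i. hd (s i)) i N)" using s unfolding win by blast
  then show thesis using ne by (intro that[of "length p" "\<lambda>i. hd (s i)"]) (auto simp: s_def)
qed

lemma closed_if_finitely_refutable:
  fixes C :: "('a \<Rightarrow> 'b::discrete_topology) set"
  assumes "\<And>x. x \<notin> C \<Longrightarrow> \<exists>F. finite F \<and> (\<forall>y. (\<forall>i\<in>F. y i = x i) \<longrightarrow> y \<notin> C)"
  shows "closed C"
proof -
  have "\<exists>U. open U \<and> x \<in> U \<and> U \<subseteq> - C" if x: "x \<in> - C" for x
  proof -
    obtain F where F: "finite F" "\<And>y. (\<forall>i\<in>F. y i = x i) \<Longrightarrow> y \<notin> C"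
      using assms[of x] x by auto
    have "open {y. \<forall>i\<in>F. y (id i) \<in> {x i}}"
      by (intro product_topology_basis' F open_discrete)
    then show ?thesis using F(2) by (intro exI[of _ "{y. \<forall>i\<in>F. y (id i) \<in> {x i}}"]) auto
  qed
  then have "open (- C)" by (subst open_subopen) blast
  then show ?thesis by (simp add: closed_def)
qed

lemma compact_if_closed_finite_alphabet:
  fixes C :: "('a \<Rightarrow> 'b::topological_space) set"
  assumes "closed C" "finite A" "\<And>x i. x \<in> C \<Longrightarrow> x i \<in> A"
  shows "compact C"
proof -
  have "compactin (product_topology (\<lambda>i::'a. euclidean) UNIV) (PiE UNIV (\<lambda>i::'a. A))"
    using finite_imp_compact[OF assms(2)] by (auto simp: compactin_PiE)
  then have "compact (PiE UNIV (\<lambda>i::'a. A))"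
    by (simp only: euclidean_product_topology compactin_euclidean_iff)
  moreover have "C \<subseteq> PiE UNIV (\<lambda>i. A)" using assms(3) by auto
  ultimately show ?thesis using assms(1) compact_Int_closed[of "PiE UNIV (\<lambda>i. A)" C] by (simp add: Int_absorb1)
qed

lemma window_shift: "window (\<lambda>i. x (i + c)) i n = window x (i + c) n"
  by (simp add: window_def ac_simps)

text \<open>
  The words in \<open>V\<close> are the vertices of a graph with an edge from \<open>u\<close> to \<open>v\<close> if \<open>tl u = butlast v\<close>.
  Its bi-infinite walks are the sequences whose \<open>n\<close>-letter windows all lie in \<open>V\<close>.
\<close>

locale steering =
  fixes n :: nat and V :: "int list set" and f g :: "int list \<Rightarrow> int list"
  assumes n_pos: "0 < n" and finite_V: "finite V" and V_nonempty: "V \<noteq> {}"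
    and length_V: "v \<in> V \<Longrightarrow> length v = n"
    and f_step: "v \<in> V \<Longrightarrow> f v \<in> V \<and> tl v = butlast (f v)"
    and g_step: "v \<in> V \<Longrightarrow> g v \<in> V \<and> tl (g v) = butlast v"
    and only_successor: "two_way V f g K \<Longrightarrow> v \<in> K \<Longrightarrow> w \<in> V \<Longrightarrow> tl v = butlast w \<Longrightarrow> w = f v"
    and only_predecessor: "two_way V f g K \<Longrightarrow> v \<in> K \<Longrightarrow> w \<in> V \<Longrightarrow> tl w = butlast v \<Longrightarrow> w = g v"
begin

definition f_at :: "(int \<Rightarrow> int) \<Rightarrow> int \<Rightarrow> bool"
  where "f_at x i \<longleftrightarrow> f (window x i n) = window x (i + 1) n"

definition g_at :: "(int \<Rightarrow> int) \<Rightarrow> int \<Rightarrow> bool"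
  where "g_at x i \<longleftrightarrow> g (window x (i + 1) n) = window x i n"

text \<open>
  The condition says that there is a cut such that all steps before it follow \<open>g\<close> and all steps after it
  follow \<open>f\<close>; only the step at the cut may follow neither. Phrased for pairs of steps, it can be
  checked on finite windows, which makes the set closed. The cut may also lie at infinity.
\<close>

definition steered :: "(int \<Rightarrow> int) set"
  where "steered = {x. (\<forall>i. window x i n \<in> V) \<and> (\<forall>i j. i < j \<longrightarrow> g_at x i \<or> f_at x j)}"

lemma at_cong:
  assumes "window x i (Suc n) = window y j (Suc n)"
  shows "f_at x i \<longleftrightarrow> f_at y j" "g_at x i \<longleftrightarrow> g_at y j"
  using window_subwindow[OF assms, of 0 n] window_subwindow[OF assms, of 1 n]
  by (simp_all add: f_at_def g_at_def)

text \<open>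
  Start with \<open>v\<close> at time 0, iterate \<open>f\<close> into the future and \<open>g\<close> into the past.
\<close>

lemma steered_through:
  assumes v: "v \<in> V"
  shows "\<exists>x\<in>steered. window x 0 n = v"
proof -
  define s where "s i = (if 0 \<le> i then (f ^^ nat i) v else (g ^^ nat (- i)) v)" for i :: int
  have fV: "(f ^^ k) v \<in> V" and gV: "(g ^^ k) v \<in> V" for k
    by (induction k) (simp_all add: v f_step g_step)
  have sV: "s i \<in> V" for i using fV gV by (simp add: s_def)
  have sf: "f (s i) = s (i + 1)" if "0 \<le> i" for i
    using that by (simp add: s_def nat_add_distrib)
  have sg: "g (s (i + 1)) = s i" if "i < 0" for i
  proof (cases "i = - 1")
    case True then show ?thesis by (simp add: s_def)
  next
    case False
    then have "nat (- i) = Suc (nat (- (i + 1)))" using that by simp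
    then show ?thesis using that False by (simp add: s_def)
  qed
  define x where "x = (\<lambda>i. hd (s i))"
  have win: "window x i n = s i" for i
    unfolding x_def
  proof (rule window_of_overlapping)
    show "length (s i) = n" for i using length_V[OF sV] .
    show "tl (s i) = butlast (s (i + 1))" for i
    proof (cases "0 \<le> i")
      case True then show ?thesis using f_step[OF sV, of i] sf[of i] by simp
    next
      case False then show ?thesis using g_step[OF sV, of "i + 1"] sg[of i] by simp
    qed
  qed
  have "x \<in> steered"
    unfolding steered_def mem_Collect_eq f_at_def g_at_def win
  proof (intro conjI allI impI)
    show "g (s (i + 1)) = s i \<or> f (s j) = s (j + 1)" if "i < j" for i j
    proof (cases "0 \<le> j")
      case True then show ?thesis by (intro disjI2 sf)
    next
      case False
      then have "i < 0" using that by simp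
      then show ?thesis by (rule sg[THEN disjI1])
    qed
  qed (rule sV)
  moreover have "window x 0 n = v" by (simp add: win s_def)
  ultimately show ?thesis by blast
qed

lemma language_steered: "language steered n = V"
proof
  show "language steered n \<subseteq> V" by (auto simp: language_iff steered_def)
  show "V \<subseteq> language steered n"
  proof
    fix v assume "v \<in> V"
    then obtain x where "x \<in> steered" "window x 0 n = v" using steered_through by blast
    then show "v \<in> language steered n" using window_in_language by blast
  qed
qed

lemma steered_shift:
  assumes "x \<in> steered"
  shows "(\<lambda>i. x (i + c)) \<in> steered"
proof -
  have "f_at (\<lambda>i. x (i + c)) i = f_at x (i + c)" "g_at (\<lambda>i. x (i + c)) i = g_at x (i + c)" for i
    by (simp_all add: f_at_def g_at_def window_shift ac_simps)
  then show ?thesis using assms by (simp add: steered_def window_shift)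
qed

lemma subshift_steered: "subshift steered"
  unfolding subshift_def
proof (intro conjI)
  show "steered \<noteq> {}" using steered_through V_nonempty by blast
  show "shift_map ` steered = steered"
  proof
    show "shift_map ` steered \<subseteq> steered"
      using steered_shift[of _ 1] by (auto simp: shift_map_def)
    show "steered \<subseteq> shift_map ` steered"
    proof
      fix x assume "x \<in> steered"
      then have "(\<lambda>i. x (i + - 1)) \<in> steered" by (rule steered_shift)
      moreover have "shift_map (\<lambda>i. x (i + - 1)) = x" by (simp add: shift_map_def)
      ultimately show "x \<in> shift_map ` steered" by (metis image_eqI)
    qed
  qed
  have "closed steered"
  proof (rule closed_if_finitely_refutable)
    fix x assume "x \<notin> steered"
    then consider i where "window x i n \<notin> V" | i j where "i < j" "\<not> g_at x i" "\<not> f_at x j"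
      unfolding steered_def by blast
    then show "\<exists>F. finite F \<and> (\<forall>y. (\<forall>i\<in>F. y i = x i) \<longrightarrow> y \<notin> steered)"
    proof cases
      case 1
      have "y \<notin> steered" if agree: "\<forall>t\<in>{i..i + int n}. y t = x t" for y
      proof -
        have "window y i n = window x i n" using agree by (simp add: window_eq_iff)
        then have "window y i n \<notin> V" using 1 by simp
        then show ?thesis unfolding steered_def by blast
      qed
      then show ?thesis by (intro exI[of _ "{i..i + int n}"]) simp
    next
      case 2
      have "y \<notin> steered" if agree: "\<forall>t\<in>{i..i + int n} \<union> {j..j + int n}. y t = x t" for y
      proof -
        have eq: "window y i (Suc n) = window x i (Suc n)" "window y j (Suc n) = window x j (Suc n)"
          using agree by (simp_all add: window_eq_iff)
        have "\<not> g_at y i" "\<not> f_at y j"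
          using 2(2,3) unfolding at_cong(2)[OF eq(1)] at_cong(1)[OF eq(2)] .
        then show ?thesis using 2(1) unfolding steered_def by blast
      qed
      then show ?thesis by (intro exI[of _ "{i..i + int n} \<union> {j..j + int n}"]) simp
    qed
  qed
  moreover have "x i \<in> \<Union>(set ` V)" if "x \<in> steered" for x i
  proof -
    have "x i \<in> set (window x i n)" using n_pos nth_mem[of 0 "window x i n"] by simp
    moreover have "window x i n \<in> V" using that by (simp add: steered_def)
    ultimately show ?thesis by (rule UN_I[rotated])
  qed
  ultimately show "compact steered"
    using finite_V by (intro compact_if_closed_finite_alphabet[of _ "\<Union>(set ` V)"]) simp_all
qed

lemma two_way_in_walk:
  assumes walk: "\<And>i. window x i n \<in> V"
    and both: "\<And>k. a \<le> k \<Longrightarrow> k < a + int (card V) \<Longrightarrow> f_at x k \<and> g_at x k"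
  obtains K where "two_way V f g K" "window x a n \<in> K" "window x (a + int (card V)) n \<in> K"
proof -
  have V: "f ` V \<subseteq> V" "g ` V \<subseteq> V" using f_step g_step by (simp_all add: image_subset_iff)
  show thesis
  proof (rule two_way_if_long_path[OF finite_V V, of "\<lambda>k. window x (a + int k) n"])
    show "window x (a + int k) n \<in> V" for k by (rule walk)
    show "f (window x (a + int k) n) = window x (a + int (Suc k)) n \<and>
        g (window x (a + int (Suc k)) n) = window x (a + int k) n" if "k < card V" for k
    proof -
      have "f_at x (a + int k) \<and> g_at x (a + int k)" using that by (intro both) simp_all
      moreover have next_pos: "a + int (Suc k) = a + int k + 1" by simp
      ultimately show ?thesis unfolding f_at_def g_at_def next_pos by simp
    qed
  next
    fix K assume K: "two_way V f g K" "\<And>k. k \<le> card V \<Longrightarrow> window x (a + int k) n \<in> K"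
    show thesis using K(2)[of 0] by (intro that[OF K(1) _ K(2)[OF order_refl]]) simp
  qed
qed

text \<open>
  After a long stretch that follows both \<open>f\<close> and \<open>g\<close>, the walk is on a common cycle, where the only
  edge is the one along \<open>f\<close>.
\<close>

lemma f_at_after_two_way:
  assumes walk: "\<And>i. window x i n \<in> V"
    and both: "\<And>k. a \<le> k \<Longrightarrow> k < a + int (card V) \<Longrightarrow> f_at x k \<and> g_at x k"
  shows "f_at x (a + int (card V))"
proof -
  obtain K where "two_way V f g K" "window x (a + int (card V)) n \<in> K"
    using walk both by (rule two_way_in_walk)
  then have "window x (a + int (card V) + 1) n = f (window x (a + int (card V)) n)"
    using walk by (rule only_successor) (simp add: butlast_window tl_window)
  then show ?thesis by (simp add: f_at_def)
qed

lemma g_at_before_two_way: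
  assumes walk: "\<And>i. window x i n \<in> V"
    and both: "\<And>k. a \<le> k \<Longrightarrow> k < a + int (card V) \<Longrightarrow> f_at x k \<and> g_at x k"
  shows "g_at x (a - 1)"
proof -
  obtain K where "two_way V f g K" "window x a n \<in> K"
    using walk both by (rule two_way_in_walk)
  then have "window x (a - 1) n = g (window x a n)"
    using walk by (rule only_predecessor) (simp add: butlast_window tl_window)
  then show ?thesis by (simp add: g_at_def)
qed

text \<open>
  Suppose that some step does not follow \<open>g\<close> and, by periodicity, a later one does not follow \<open>f\<close>. For
  the closest two such steps, all steps in between follow both, and there are at least \<open>card V\<close> of
  them, because closer steps satisfy the condition \<open>near\<close>. But then the later step follows \<open>f\<close>
  after all.
\<close>

lemma f_at_or_g_at_if_periodic:
  assumes walk: "\<And>i. window z i n \<in> V"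
    and near: "\<And>i j. i < j \<Longrightarrow> j \<le> i + int (card V) \<Longrightarrow> g_at z i \<or> f_at z j"
    and P: "0 < P" "\<And>i. z (i + int P) = z i"
  shows "(\<forall>i. f_at z i) \<or> (\<forall>i. g_at z i)"
proof (rule ccontr)
  assume "\<not> ?thesis"
  then obtain i0 j0 where i0: "\<not> f_at z i0" and j0: "\<not> g_at z j0" by blast
  have period: "z (i + int (k * P)) = z i" for i k
  proof (induction k)
    case (Suc k)
    have "i + int (Suc k * P) = i + int (k * P) + int P" by simp
    then show ?case using P(2)[of "i + int (k * P)"] Suc by metis
  qed simp
  define m where "m = nat (j0 - i0 + 1) * P"
  have "window z (i + int m) n = window z i n" for i
    unfolding window_eq_iff m_def using period[of "i + int k" for k] by (metis add.assoc add.commute)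
  then have "\<not> f_at z (i0 + int m)"
    using i0 unfolding f_at_def by (metis add.assoc add.commute)
  moreover have "j0 < i0 + int m"
  proof -
    have "nat (j0 - i0 + 1) \<le> m" unfolding m_def using P(1) by simp
    then show ?thesis by linarith
  qed
  ultimately obtain j i where ji: "\<not> g_at z j" "\<not> f_at z i" "j < i"
      "\<And>k. j < k \<Longrightarrow> k < i \<Longrightarrow> \<not> \<not> g_at z k \<and> \<not> \<not> f_at z k"
    using closest_pair[of "\<lambda>k. \<not> g_at z k" j0 "\<lambda>k. \<not> f_at z k" "i0 + int m", OF j0] by blast
  have "j + int (card V) < i" using near[of j i] ji(1-3) by linarith
  then have "f_at z ((i - int (card V)) + int (card V))"
    using ji(4) by (intro f_at_after_two_way walk) auto
  then show False using ji(2) by simp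
qed

text \<open>
  An arc, a word of length \<open>n + 1 + card V\<close>, contains \<open>card V + 1\<close> steps, and a vertex contains
  \<open>card V\<close> steps. A cycle is a periodic sequence \<open>z\<close>. If \<open>z\<close> follows \<open>f\<close>, consider
  an arc from a vertex of the cycle: either its last step follows \<open>f\<close> and the arc stays on
  the cycle, or all earlier steps follow both \<open>f\<close> and \<open>g\<close>, which forces the last
  step to follow \<open>f\<close>. If \<open>z\<close> follows \<open>g\<close>, the mirrored argument applies to arcs that end on the
  cycle.
\<close>

lemma no_middle_cycles_steered:
  "no_middle_cycles (rauzy_graph steered (n + 1 + card V))"
proof -
  define M where "M = card V"
  define N where "N = n + 1 + M"
  have one_way: "\<not> (\<exists>e\<in>language steered N. tl e \<in> butlast ` set p \<and> butlast e \<notin> butlast ` set p)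
      \<or> \<not> (\<exists>e\<in>language steered N. butlast e \<in> butlast ` set p \<and> tl e \<notin> butlast ` set p)"
    if p: "pre_digraph.cycle (rauzy_graph steered N) p" for p
  proof -
    obtain P z where P: "0 < P" "\<And>i. z (i + int P) = z i" and set_p: "set p = range (\<lambda>i. window z i N)"
      by (rule rauzy_cycle_sequence[OF p]) (rule that)
    have K: "butlast ` set p = range (\<lambda>i. window z i (N - 1))"
      unfolding set_p image_image butlast_window ..
    have "set p \<subseteq> language steered N"
      using p unfolding pre_digraph.cycle_def pre_digraph.awalk_def by (auto simp: rauzy_graph_def)
    then have local: "\<exists>y\<in>steered. \<exists>s. window z i N = window y s N" for i
      unfolding set_p image_subset_iff using language_iff[of "window z i N" steered N] by blast
    have walk_y: "window y i n \<in> V" if "y \<in> steered" for y i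
      using that unfolding steered_def by blast
    have pair_y: "g_at y i \<or> f_at y j" if "y \<in> steered" "i < j" for y i j
      using that unfolding steered_def by blast
    have walk_z: "window z i n \<in> V" for i
    proof -
      obtain y s where y: "y \<in> steered" "window z i N = window y s N" using local by blast
      then have "window z i n = window y s n"
        using window_subwindow[OF y(2), of 0 n] by (simp add: N_def)
      then show ?thesis using walk_y[OF y(1)] by simp
    qed
    have pair_z: "g_at z i \<or> f_at z j" if ij: "i < j" "j \<le> i + int M" for i j
    proof -
      obtain y s where y: "y \<in> steered" "window z i N = window y s N" using local by blast
      have at_i: "window z i (Suc n) = window y s (Suc n)"
        using window_subwindow[OF y(2), of 0 "Suc n"] by (simp add: N_def)
      have at_j: "window z j (Suc n) = window y (s + (j - i)) (Suc n)"
        using window_subwindow[OF y(2), of "nat (j - i)" "Suc n"] ij by (simp add: N_def)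
      show ?thesis
        unfolding at_cong(2)[OF at_i] at_cong(1)[OF at_j] using ij(1) by (intro pair_y[OF y(1)]) simp
    qed
    have "(\<forall>i. f_at z i) \<or> (\<forall>i. g_at z i)"
      using walk_z pair_z P unfolding M_def by (rule f_at_or_g_at_if_periodic)
    then show ?thesis
    proof
      assume all_f: "\<forall>i. f_at z i"
      have "tl e \<in> butlast ` set p" if e: "e \<in> language steered N" "butlast e \<in> butlast ` set p" for e
      proof -
        obtain y s where y: "y \<in> steered" "e = window y s N" using e(1) unfolding language_iff by blast
        obtain t where t: "window y s (N - 1) = window z t (N - 1)"
          using e(2) unfolding K y(2) butlast_window by blast
        have f_y: "f_at y k" if k: "s \<le> k" "k < s + int M" for k
        proof -
          have eq: "window y k (Suc n) = window z (t + (k - s)) (Suc n)"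
            using window_subwindow[OF t, of "nat (k - s)" "Suc n"] k by (simp add: N_def)
          show ?thesis using all_f by (simp only: at_cong(1)[OF eq])
        qed
        have "f_at y (s + int M)"
        proof (rule ccontr)
          assume not_f: "\<not> f_at y (s + int M)"
          have "f_at y k \<and> g_at y k" if "s \<le> k" "k < s + int M" for k
            using f_y[OF that] pair_y[OF y(1) that(2)] not_f by blast
          then have "f_at y (s + int M)"
            unfolding M_def using walk_y[OF y(1)] by (intro f_at_after_two_way)
          then show False using not_f by blast
        qed
        moreover have "window y (s + int M) n = window z (t + int M) n"
          using window_subwindow[OF t, of M n] by (simp add: N_def)
        moreover have "f_at z (t + int M)" using all_f by blast
        ultimately have last: "window y (s + int M + 1) n = window z (t + int M + 1) n"
          unfolding f_at_def by argo
        \<comment> \<open>All letters but the last are shared with the tail of the arc; the last one comes from the last step.\<close>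
        have "window y (s + 1) (N - 1) = window z (t + 1) (N - 1)"
          unfolding window_eq_iff
        proof (intro allI impI)
          fix k assume "k < N - 1"
          then consider "Suc k < N - 1" | "k = M + (n - 1)" using n_pos unfolding N_def by linarith
          then show "y (s + 1 + int k) = z (t + 1 + int k)"
          proof cases
            case 1
            then show ?thesis using window_eqD[OF t, of "s + 1 + int k"] by (simp add: ac_simps)
          next
            case 2
            then show ?thesis
              using window_eqD[OF last, of "s + 1 + int k"] n_pos by (simp add: ac_simps)
          qed
        qed
        then show ?thesis unfolding K y(2) tl_window by blast
      qed
      then show ?thesis by blast
    next
      assume all_g: "\<forall>i. g_at z i"
      have "butlast e \<in> butlast ` set p" if e: "e \<in> language steered N" "tl e \<in> butlast ` set p" for e
      proof -
        obtain y s where y: "y \<in> steered" "e = window y s N" using e(1) unfolding language_iff by blast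
        obtain t where t: "window y (s + 1) (N - 1) = window z t (N - 1)"
          using e(2) unfolding K y(2) tl_window by blast
        have g_y: "g_at y k" if k: "s + 1 \<le> k" "k < s + 1 + int M" for k
        proof -
          have eq: "window y k (Suc n) = window z (t + (k - (s + 1))) (Suc n)"
            using window_subwindow[OF t, of "nat (k - (s + 1))" "Suc n"] k by (simp add: N_def)
          show ?thesis using all_g by (simp only: at_cong(2)[OF eq])
        qed
        have "g_at y s"
        proof (rule ccontr)
          assume not_g: "\<not> g_at y s"
          have "f_at y k \<and> g_at y k" if "s + 1 \<le> k" "k < s + 1 + int M" for k
            using g_y[OF that] pair_y[OF y(1), of s k] that(1) not_g by auto
          then have "g_at y (s + 1 - 1)"
            unfolding M_def using walk_y[OF y(1)] by (intro g_at_before_two_way)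
          then show False using not_g by simp
        qed
        moreover have "window y (s + 1) n = window z (t - 1 + 1) n"
          using window_subwindow[OF t, of 0 n] by (simp add: N_def)
        moreover have "g_at z (t - 1)" using all_g by blast
        ultimately have first: "window y s n = window z (t - 1) n"
          unfolding g_at_def by argo
        have "window y s (N - 1) = window z (t - 1) (N - 1)"
          unfolding window_eq_iff
        proof (intro allI impI)
          fix k assume k: "k < N - 1"
          show "y (s + int k) = z (t - 1 + int k)"
          proof (cases "k = 0")
            case True
            then show ?thesis using window_eqD[OF first, of s] n_pos by simp
          next
            case False
            then show ?thesis using window_eqD[OF t, of "s + int k"] k by (simp add: algebra_simps)
          qed
        qed
        then show ?thesis unfolding K y(2) butlast_window by blast
      qed
      then show ?thesis by blast
    qed
  qed
  have G: "tail (rauzy_graph steered N) = butlast" "head (rauzy_graph steered N) = tl"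
    "arcs (rauzy_graph steered N) = language steered N"
    by (simp_all add: rauzy_graph_def)
  have "no_middle_cycles (rauzy_graph steered N)"
    unfolding no_middle_cycles_def Let_def G
  proof (rule notI, elim exE conjE)
    fix p assume "pre_digraph.cycle (rauzy_graph steered N) p"
      and "\<exists>e\<in>language steered N. tl e \<in> butlast ` set p \<and> butlast e \<notin> butlast ` set p"
      and "\<exists>e\<in>language steered N. butlast e \<in> butlast ` set p \<and> tl e \<notin> butlast ` set p"
    then show False using one_way[of p] by argo
  qed
  then show ?thesis unfolding N_def M_def .
qed

end

section \<open>Isolation, density and residuality\<close>

lemma language_neighbours:
  assumes X: "subshift X" and v: "v \<in> language X n"
  shows "\<exists>w\<in>language X n. tl v = butlast w" "\<exists>u\<in>language X n. tl u = butlast v"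
proof -
  obtain x i where x: "x \<in> X" "v = window x i n" using v unfolding language_iff by blast
  show "\<exists>w\<in>language X n. tl v = butlast w"
    by (rule bexI[of _ "window x (i + 1) n"]) (simp_all add: x window_in_language butlast_window tl_window)
  show "\<exists>u\<in>language X n. tl u = butlast v"
    by (rule bexI[of _ "window x (i - 1) n"]) (simp_all add: x window_in_language butlast_window tl_window)
qed

text \<open>
  The steered subshift for an isolating choice on the \<open>n\<close>-letter words of \<open>X\<close>.
\<close>

lemma NMC_approximates:
  assumes X: "subshift X" and n: "0 < n"
  shows "\<exists>Y\<in>NMC. language Y n = language X n"
proof -
  obtain f g where f: "\<And>v. v \<in> language X n \<Longrightarrow> f v \<in> language X n \<and> tl v = butlast (f v)"
    and g: "\<And>v. v \<in> language X n \<Longrightarrow> g v \<in> language X n \<and> tl (g v) = butlast v"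
    and succ: "\<And>K v w. two_way (language X n) f g K \<Longrightarrow> v \<in> K \<Longrightarrow> w \<in> language X n \<Longrightarrow>
      tl v = butlast w \<Longrightarrow> w = f v"
    and pred: "\<And>K v w. two_way (language X n) f g K \<Longrightarrow> v \<in> K \<Longrightarrow> w \<in> language X n \<Longrightarrow>
      tl w = butlast v \<Longrightarrow> w = g v"
  proof (rule exists_isolating_choice[of "language X n" "\<lambda>u w. tl u = butlast w"])
    show "finite (language X n)" by (rule finite_language[OF X])
    show "\<exists>w\<in>language X n. tl v = butlast w" "\<exists>u\<in>language X n. tl u = butlast v"
      if "v \<in> language X n" for v
      using that by (rule language_neighbours[OF X])+
  qed (rule that)
  interpret steering n "language X n" f g
  proof (unfold_locales, fact n)
    show "finite (language X n)" by (rule finite_language[OF X])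
    obtain x where "x \<in> X" using X unfolding subshift_def by blast
    then show "language X n \<noteq> {}" using window_in_language by blast
    show "length v = n" if "v \<in> language X n" for v using that by (rule length_language)
  qed (rule f g succ pred; assumption)+
  have "steered \<in> NMC"
    using subshift_steered no_middle_cycles_steered n unfolding NMC_def subshifts_def
    by (intro CollectI conjI exI[of _ "n + 1 + card (language X n)"]) simp_all
  then show ?thesis using language_steered by blast
qed

lemma subshift_dist_less_imp_language_eq:
  assumes "subshift_dist X Y < (1 / 2) ^ n"
  shows "language X n = language Y n"
proof (rule ccontr)
  assume neq: "language X n \<noteq> language Y n"
  then have "Inf {n. language X n \<noteq> language Y n} \<le> n" by (intro cInf_lower) auto
  then have "(1 / 2 :: real) ^ n \<le> (1 / 2) ^ Inf {n. language X n \<noteq> language Y n}"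
    by (intro power_decreasing) auto
  moreover have "X \<noteq> Y" using neq by blast
  ultimately show False using assms by (simp add: subshift_dist_def)
qed

lemma subshift_dist_less_if_language_eq:
  assumes XY: "X \<in> subshifts" "Y \<in> subshifts" and eq: "language X n = language Y n"
  shows "subshift_dist X Y < (1 / 2) ^ n"
proof (cases "X = Y")
  case False
  let ?I = "Inf {n. language X n \<noteq> language Y n}"
  have "language X ?I \<noteq> language Y ?I"
    using Inf_nat_def1[of "{n. language X n \<noteq> language Y n}"] language_neq_ex[OF XY False] by auto
  moreover have "language X m = language Y m" if "m \<le> n" for m
    using language_subset_mono[OF _ that, of X Y] language_subset_mono[OF _ that, of Y X] eq by blast
  ultimately have "n < ?I" by (meson not_le_imp_less)
  then have "(1 / 2 :: real) ^ ?I < (1 / 2) ^ n" by (intro power_strict_decreasing) auto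
  then show ?thesis using False by (simp add: subshift_dist_def)
qed (simp add: subshift_dist_def)

lemma openin_NMC_singleton:
  assumes X: "X \<in> NMC"
  shows "openin subshift_topology {X}"
proof -
  interpret Metric_space subshifts subshift_dist by (rule Metric_space_subshifts)
  obtain n where n: "2 \<le> n" "no_middle_cycles (rauzy_graph X n)" and sub: "X \<in> subshifts"
    using X unfolding NMC_def by blast
  define N where "N = n + card (language X (n - 1))"
  have "Y = X" if Y: "Y \<in> mball X ((1 / 2) ^ N)" for Y
  proof -
    have Y': "Y \<in> subshifts" "language X N = language Y N"
      using Y subshift_dist_less_imp_language_eq by (simp_all add: in_mball)
    have "language X m = language Y m" for m
      using language_eq_if_no_middle_cycles[OF _ n] sub Y'(2)
      unfolding N_def subshifts_def by blast
    then show ?thesis using language_neq_ex[OF sub Y'(1)] by blast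
  qed
  moreover have "X \<in> mball X ((1 / 2) ^ N)" using sub by simp
  ultimately have "{X} = mball X ((1 / 2) ^ N)" by blast
  then show ?thesis unfolding subshift_topology_def by (metis openin_mball)
qed

lemma dense_in_NMC: "dense_in subshift_topology NMC"
proof -
  interpret Metric_space subshifts subshift_dist by (rule Metric_space_subshifts)
  have "\<exists>Y\<in>NMC. Y \<in> mball X r" if X: "X \<in> subshifts" and r: "0 < r" for X r
  proof -
    obtain n where n: "(1 / 2 :: real) ^ n < r" using real_arch_pow_inv[OF r, of "1 / 2"] by auto
    obtain Y where Y: "Y \<in> NMC" "language Y (Suc n) = language X (Suc n)"
      using NMC_approximates[of X "Suc n"] X unfolding subshifts_def by blast
    have YS: "Y \<in> subshifts" using Y(1) by (simp add: NMC_def)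
    have "language X n = language Y n"
      using language_subset_mono[of X "Suc n" Y n] language_subset_mono[of Y "Suc n" X n] Y(2) by simp
    then have "subshift_dist X Y < (1 / 2) ^ n"
      by (rule subshift_dist_less_if_language_eq[OF X YS])
    then show ?thesis using n X Y YS by (intro bexI[of _ Y]) (auto simp: in_mball)
  qed
  then have "mtopology closure_of NMC = subshifts" unfolding metric_closure_of by blast
  moreover have "NMC \<subseteq> subshifts" by (auto simp: NMC_def)
  ultimately show ?thesis
    unfolding dense_in_def topspace_subshift_topology by (simp add: subshift_topology_def)
qed

theorem theorem3p6:
  shows "(\<forall>X \<in> NMC. openin subshift_topology {X}) \<and>
         dense_in subshift_topology NMC \<and>
         residual_in subshift_topology NMC"
proof -
  have "openin subshift_topology (\<Union>X\<in>NMC. {X})"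
    using openin_NMC_singleton by (intro openin_Union) auto
  then have "gdelta_in subshift_topology NMC" by (simp add: open_imp_gdelta_in)
  then have "residual_in subshift_topology NMC"
    using dense_in_NMC unfolding residual_in_def dense_in_def by blast
  then show ?thesis using openin_NMC_singleton dense_in_NMC by blast
qed

end
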